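(* Let $a,b,c,d$ be positive integers with $ad-bc>0$ and $\gcd(a,b)=\gcd(c,d)=1$, and let \[ \Omega_A=\{(z_1,z_2)\in\mathbb{C}^2: |z_1|^a<|z_2|^b,\ |z_2|^d<|z_1|^c\}. \] For $1\le p<\infty$, the $p$-allowable index set of $\Omega_A$ is \[ S_p(\Omega_A)=\left\{(\alpha_1,\alpha_2)\in\mathbb{Z}^2 : (a\alpha_2+b\alpha_1)p>-2(a+b),\ (c\alpha_2+d\alpha_1)p>-2(c+d)\right\}. \] Moreover, the set of Threshold exponents of $\Omega_A$ is \[ \mathrm{Threshold}(\Omega_A)=\left\{\frac{2(a+b)}{j},\ \frac{2(c+d)}{k} : j,k\in\mathbb{Z},\ 1\le j\le 2(a+b)-1,\ 1\le k\le 2(c+d)-1\right\}. \]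
   Context: For a domain $\Omega\subset\mathbb{C}^n$ and $1\le p<\infty$, $A^p(\Omega)$ denotes the space of holomorphic functions $f$ on $\Omega$ with $\int_\Omega|f|^p\,dV<\infty$, where $dV$ is Lebesgue measure. For $\alpha\in\mathbb{Z}^n$, $e_\alpha(z):=z_1^{\alpha_1}\cdots z_n^{\alpha_n}$ (a Laurent monomial if some exponents are negative), and $S_p(\Omega):=\{\alpha\in\mathbb{Z}^n: e_\alpha\in A^p(\Omega)\}$ is the $p$-allowable index set. A number $p\in[1,\infty)$ is a Threshold exponent for $\Omega$ if for every $\varepsilon>0$ there exists $q\in(p-\varepsilon,p+\varepsilon)$ (with $q\ge1$, since $S_q$ is defined only for $q\in[1,\infty)$) such that $S_q(\Omega)\ne S_p(\Omega)$. $\mathrm{Threshold}(\Omega)$ denotes the set of Threshold exponents of $\Omega$. *)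

theory Defs
  imports "HOL-Analysis.Analysis"
begin

text \<open>
  Points of \<open>\<complex>\<^sup>n\<close> are vectors of type \<open>complex ^ 'n\<close>; this type is a Euclidean space of
  real dimension \<open>2n\<close>, and \<open>lebesgue\<close> on it is the usual volume measure.
\<close>

text \<open>
  Holomorphy in several variables: \<open>f\<close> has at every point of \<open>\<Omega>\<close> a total derivative that is
  complex linear (the library's \<open>holomorphic_on\<close> is for one variable only).
\<close>

definition holomorphic_cn :: "(complex ^ 'n \<Rightarrow> complex) \<Rightarrow> (complex ^ 'n) set \<Rightarrow> bool" where
  "holomorphic_cn f \<Omega> \<longleftrightarrow>
     (\<forall>z\<in>\<Omega>. \<exists>f'. (f has_derivative f') (at z) \<and> (\<forall>c v. f' (c *s v) = c * f' v))"

text \<open>Membership only depends on the restriction of \<open>f\<close> to the domain \<open>\<Omega>\<close>.\<close>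

definition bergman_space :: "real \<Rightarrow> (complex ^ 'n) set \<Rightarrow> (complex ^ 'n \<Rightarrow> complex) set" where
  "bergman_space p \<Omega> =
     {f. holomorphic_cn f \<Omega> \<and>
         (\<integral>\<^sup>+z\<in>\<Omega>. ennreal (norm (f z) powr p) \<partial>lebesgue) < \<infinity>}"

text \<open>
  Since \<open>inverse 0 = 0\<close>, a Laurent monomial gets a junk value where a variable with negative exponent
  vanishes. This is harmless: it is unbounded near such points of an open set, hence not
  holomorphic there.
\<close>

definition laurent_monomial :: "int ^ 'n \<Rightarrow> complex ^ 'n \<Rightarrow> complex" where
  "laurent_monomial \<alpha> z = (\<Prod>i\<in>UNIV. (z $ i) powi (\<alpha> $ i))"

definition allowable :: "real \<Rightarrow> (complex ^ 'n) set \<Rightarrow> (int ^ 'n) set" where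
  "allowable p \<Omega> = {\<alpha>. laurent_monomial \<alpha> \<in> bergman_space p \<Omega>}"

definition Threshold :: "(complex ^ 'n) set \<Rightarrow> real set" where
  "Threshold \<Omega> =
     {p. 1 \<le> p \<and>
         (\<forall>\<epsilon>>0. \<exists>q\<in>{p - \<epsilon><..<p + \<epsilon>}. 1 \<le> q \<and> allowable q \<Omega> \<noteq> allowable p \<Omega>)}"

definition Omega_A :: "nat \<Rightarrow> nat \<Rightarrow> nat \<Rightarrow> nat \<Rightarrow> (complex ^ 2) set" where
  "Omega_A a b c d =
     {z. norm (z $ 1) ^ a < norm (z $ 2) ^ b \<and> norm (z $ 2) ^ d < norm (z $ 1) ^ c}"

end

theory Submission
  imports Defs
begin

text \<open>
  In the coordinates \<open>s = - ln |z\<^sub>1|\<close>, \<open>t = - ln |z\<^sub>2|\<close> the domain becomes the cone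
  \<open>b t < a s\<close>, \<open>c s < d t\<close> and the integral of \<open>|e\<^sub>\<alpha>|\<^sup>p\<close> becomes that of an exponential of a
  linear form over this cone. The linear coordinates \<open>u = a s - b t\<close>, \<open>v = d t - c s\<close> split it into
  a product of two one-dimensional exponential integrals, whose convergence gives the two
  inequalities. Each inequality reads \<open>m p > - M\<close> with an integer \<open>m\<close>, so the index set can only
  jump at \<open>p = M / j\<close>; by coprimality it does, and \<open>p = 1\<close> drops out because
  only exponents \<open>q \<ge> 1\<close> are compared.
\<close>

section \<open>Exponential integrals over the half-line\<close>

text \<open>On the unit interval the integrand is at least \<open>exp (- \<bar>l\<bar>)\<close>.
  Positivity matters because \<open>0 * \<infinity> = 0\<close> in \<open>ennreal\<close>: a finite
  product has finite factors only if neither factor is zero.\<close>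

lemma nn_integral_exp_Ioi_pos:
  "0 < (\<integral>\<^sup>+x. indicator {0<..} x * ennreal (exp (- (l * x))) \<partial>lborel)"
proof -
  have "0 < ennreal (exp (- \<bar>l\<bar>)) * emeasure lborel {0<..<1::real}"
    by simp
  also have "\<dots> = (\<integral>\<^sup>+x. ennreal (exp (- \<bar>l\<bar>)) * indicator {0<..<1::real} x \<partial>lborel)"
    by (subst nn_integral_cmult_indicator) auto
  also have "\<dots> \<le> (\<integral>\<^sup>+x. indicator {0<..} x * ennreal (exp (- (l * x))) \<partial>lborel)"
  proof (intro nn_integral_mono)
    fix x :: real
    have "l * x \<le> \<bar>l\<bar>" if "0 < x" "x < 1"
    proof -
      have "l * x \<le> \<bar>l\<bar> * x"
        using that by (intro mult_right_mono) auto
      also have "\<dots> \<le> \<bar>l\<bar> * 1"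
        using that by (intro mult_left_mono) auto
      finally show ?thesis by simp
    qed
    then show "ennreal (exp (- \<bar>l\<bar>)) * indicator {0<..<1} x
        \<le> indicator {0<..} x * ennreal (exp (- (l * x)))"
      by (auto simp: indicator_def intro!: ennreal_leI)
  qed
  finally show ?thesis .
qed

text \<open>For positive \<open>l\<close> the antiderivative \<open>- exp (- (l * x)) / l\<close>
  tends to 0 at infinity. For \<open>l \<le> 0\<close> the integrand is at least 1 on the whole
  half-line, so the integral exceeds every natural number.\<close>

lemma nn_integral_exp_Ioi_finite_iff:
  "(\<integral>\<^sup>+x. indicator {0<..} x * ennreal (exp (- (l * x))) \<partial>lborel) < \<infinity> \<longleftrightarrow> 0 < l"
proof
  assume l: "0 < l"
  have "((\<lambda>x. - exp (- (l * x)) / l) \<longlongrightarrow> 0) at_top"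
  proof -
    have "filterlim (\<lambda>x. l * x) at_top at_top"
      by (rule filterlim_tendsto_pos_mult_at_top[OF tendsto_const l filterlim_ident])
    then have "((\<lambda>x. exp (- (l * x))) \<longlongrightarrow> 0) at_top"
      by (intro filterlim_compose[OF exp_at_bot] filterlim_compose[OF filterlim_uminus_at_bot_at_top])
    then have "((\<lambda>x. - exp (- (l * x)) / l) \<longlongrightarrow> - 0 / l) at_top"
      using l by (intro tendsto_intros) auto
    then show ?thesis by simp
  qed
  then have "(\<integral>\<^sup>+x. ennreal (exp (- (l * x))) * indicator {0..} x \<partial>lborel)
      = ennreal (0 - (- exp (- (l * 0)) / l))"
    using l by (intro nn_integral_FTC_atLeast)
      (auto intro!: derivative_eq_intros)
  then have "(\<integral>\<^sup>+x. ennreal (exp (- (l * x))) * indicator {0..} x \<partial>lborel) < \<infinity>"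
    by (simp only: ennreal_less_top infinity_ennreal_def)
  moreover have "(\<integral>\<^sup>+x. indicator {0<..} x * ennreal (exp (- (l * x))) \<partial>lborel)
      \<le> (\<integral>\<^sup>+x. ennreal (exp (- (l * x))) * indicator {0..} x \<partial>lborel)"
    by (intro nn_integral_mono) (auto simp: indicator_def)
  ultimately show "(\<integral>\<^sup>+x. indicator {0<..} x * ennreal (exp (- (l * x))) \<partial>lborel) < \<infinity>"
    by (rule le_less_trans[rotated])
next
  assume fin: "(\<integral>\<^sup>+x. indicator {0<..} x * ennreal (exp (- (l * x))) \<partial>lborel) < \<infinity>"
  show "0 < l"
  proof (rule ccontr)
    assume l: "\<not> 0 < l"
    have "of_nat n \<le> (\<integral>\<^sup>+x. indicator {0<..} x * ennreal (exp (- (l * x))) \<partial>lborel)" for n :: nat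
    proof -
      have "of_nat n = emeasure lborel {0<..<real n}"
        by (simp add: ennreal_of_nat_eq_real_of_nat)
      also have "\<dots> = (\<integral>\<^sup>+x. indicator {0<..<real n} x \<partial>lborel)"
        by simp
      also have "\<dots> \<le> (\<integral>\<^sup>+x. indicator {0<..} x * ennreal (exp (- (l * x))) \<partial>lborel)"
        using l by (intro nn_integral_mono)
          (auto simp: indicator_def mult_nonpos_nonneg)
      finally show ?thesis .
    qed
    with fin show False
      using ennreal_Ex_less_of_nat by (force simp flip: not_less)
  qed
qed

section \<open>Passage to logarithmic coordinates\<close>

text \<open>This identifies the image of planar Lebesgue measure under \<open>- ln (norm z)\<close>.
  Up to a null set, the preimage of \<open>{x<..}\<close> is a disc of radius
  \<open>exp (- x)\<close> and area \<open>pi * exp (- 2 * x)\<close>; the density on the right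
  gives \<open>{x<..}\<close> the same mass, and finite masses of these half-lines determine the
  measure.\<close>

lemma nn_integral_neg_ln_norm:
  assumes [measurable]: "f \<in> borel_measurable borel"
  shows "(\<integral>\<^sup>+z. f (- ln (norm (z :: complex))) \<partial>lborel)
    = (\<integral>\<^sup>+s. ennreal (2 * pi * exp (- 2 * s)) * f s \<partial>lborel)"
proof -
  let ?M = "distr lborel borel (\<lambda>z::complex. - ln (norm z))"
  let ?N = "density lborel (\<lambda>s. ennreal (2 * pi * exp (- 2 * s)))"
  have M: "emeasure ?M {x<..} = ennreal (pi * exp (- 2 * x))" for x
  proof -
    have "emeasure ?M {x<..} = emeasure lborel ((\<lambda>z::complex. - ln (norm z)) -` {x<..})"
      by (subst emeasure_distr) auto
    \<comment> \<open>The two sets can differ only at the origin, where \<open>ln 0 = 0\<close> is a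
      default value; hence equality almost everywhere.\<close>
    also have "\<dots> = emeasure lborel (ball (0::complex) (exp (- x)))"
    proof (rule emeasure_eq_AE)
      show "AE z in lborel. (z \<in> (\<lambda>z::complex. - ln (norm z)) -` {x<..})
          = (z \<in> ball 0 (exp (- x)))"
        using AE_lborel_singleton[of "0::complex"]
      proof eventually_elim
        case (elim z)
        then have "ln (norm z) < - x \<longleftrightarrow> norm z < exp (- x)"
          by (metis exp_less_cancel_iff exp_ln zero_less_norm_iff)
        then show ?case by auto
      qed
      show "(\<lambda>z::complex. - ln (norm z)) -` {x<..} \<in> sets lborel"
        using measurable_sets[of "\<lambda>z::complex. - ln (norm z)" lborel borel "{x<..}"] by simp
    qed auto
    also have "\<dots> = ennreal (pi * exp (- 2 * x))"
      by (subst emeasure_ball) (auto simp: unit_ball_vol_2 simp flip: exp_double)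
    finally show ?thesis .
  qed
  have N: "emeasure ?N {x<..} = ennreal (pi * exp (- 2 * x))" for x
  proof -
    have "((\<lambda>s. - pi * exp (- 2 * s)) \<longlongrightarrow> 0) at_top"
    proof -
      have "filterlim (\<lambda>s::real. 2 * s) at_top at_top"
        by (rule filterlim_tendsto_pos_mult_at_top[OF tendsto_const _ filterlim_ident]) simp
      then have "((\<lambda>s::real. exp (- (2 * s))) \<longlongrightarrow> 0) at_top"
        by (intro filterlim_compose[OF exp_at_bot] filterlim_compose[OF filterlim_uminus_at_bot_at_top])
      from tendsto_mult[OF tendsto_const[of "- pi"] this] show ?thesis
        by simp
    qed
    then have "(\<integral>\<^sup>+s. ennreal (2 * pi * exp (- 2 * s)) * indicator {x..} s \<partial>lborel)
        = ennreal (0 - (- pi * exp (- 2 * x)))"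
      by (intro nn_integral_FTC_atLeast) (auto intro!: derivative_eq_intros)
    \<comment> \<open>Adding the endpoint, a null set, gives the closed half-line to which the
      fundamental theorem of calculus was applied.\<close>
    moreover have "emeasure ?N {x<..}
        = (\<integral>\<^sup>+s. ennreal (2 * pi * exp (- 2 * s)) * indicator {x..} s \<partial>lborel)"
    proof (subst emeasure_density; simp?)
      show "(\<integral>\<^sup>+s. ennreal (2 * pi * exp (- (2 * s))) * indicator {x<..} s \<partial>lborel)
        = (\<integral>\<^sup>+s. ennreal (2 * pi * exp (- (2 * s))) * indicator {x..} s \<partial>lborel)"
        using AE_lborel_singleton[of x]
        by (intro nn_integral_cong_AE) (auto simp: indicator_def elim!: eventually_mono)
    qed
    ultimately show ?thesis by simp
  qed
  have "?M = ?N"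
  proof (rule measure_eqI_lessThan)
    show "emeasure ?M {x<..} < \<infinity>" "emeasure ?M {x<..} = emeasure ?N {x<..}" for x
      unfolding M N by simp_all
  qed simp_all
  have "(\<integral>\<^sup>+z. f (- ln (norm (z :: complex))) \<partial>lborel) = (\<integral>\<^sup>+s. f s \<partial>?M)"
    by (subst nn_integral_distr) auto
  also have "\<dots> = (\<integral>\<^sup>+s. ennreal (2 * pi * exp (- 2 * s)) * f s \<partial>lborel)"
    unfolding \<open>?M = ?N\<close> by (subst nn_integral_density) auto
  finally show ?thesis .
qed

lemma borel_measurable_vec2:
  "(\<lambda>(x, y). (\<chi> i. if i = 1 then x else y) :: 'a ^ 2)
     \<in> borel_measurable (borel :: ('a::euclidean_space \<times> 'a) measure)"
proof (rule borel_measurable_continuous_onI)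
  have "continuous_on UNIV (\<lambda>z. if i = 1 then fst z else snd z :: 'a)" for i :: 2
    by (cases "i = 1") (auto intro!: continuous_intros)
  then show "continuous_on UNIV (\<lambda>(x, y). (\<chi> i. if i = 1 then x else y) :: 'a ^ 2)"
    unfolding case_prod_beta by (rule continuous_on_vec_lambda)
qed

text \<open>Lebesgue measure is determined by its values on boxes, and a box of vectors is a product
  of two boxes of components. This makes Fubini's theorem for pairs available on vectors of length
  two.\<close>

lemma lborel_vec2_eq_distr:
  "(lborel :: ('a::euclidean_space ^ 2) measure)
     = distr (lborel \<Otimes>\<^sub>M lborel) borel (\<lambda>(x, y). \<chi> i. if i = 1 then x else y)"
proof (rule lborel_eqI)
  fix l u :: "'a ^ 2"
  assume le: "\<And>b. b \<in> Basis \<Longrightarrow> l \<bullet> b \<le> u \<bullet> b"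
  have le': "l $ i \<bullet> b \<le> u $ i \<bullet> b" if "b \<in> Basis" for i b
    using le[of "axis i b"] that by (auto simp: Basis_vec_def inner_axis)
  \<comment> \<open>The basis is the disjoint union of two copies of the component basis, so the
    volume product over it factors.\<close>
  have Basis2: "(Basis :: ('a ^ 2) set) = axis 1 ` Basis \<union> axis 2 ` Basis"
    unfolding Basis_vec_def UNIV_2 by auto
  have disj: "axis 1 ` Basis \<inter> axis 2 ` (Basis :: 'a set) = ({} :: ('a ^ 2) set)"
    by (auto simp: axis_eq_axis)
  have inj: "inj_on (axis i) (Basis :: 'a set)" for i :: 2
    by (auto simp: inj_on_def axis_eq_axis)
  have "(\<lambda>(x, y). (\<chi> i. if i = 1 then x else y) :: 'a ^ 2) -` box l u
      = box (l $ 1) (u $ 1) \<times> box (l $ 2) (u $ 2)"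
    by (simp add: set_eq_iff mem_box Basis2 ball_Un inner_axis)
  moreover have "emeasure (lborel \<Otimes>\<^sub>M lborel) (box (l $ 1) (u $ 1) \<times> box (l $ 2) (u $ 2))
      = ennreal (\<Prod>b\<in>Basis. (u - l) \<bullet> b)"
    by (subst lborel.emeasure_pair_measure_Times)
      (auto simp: le' Basis2 prod.union_disjoint disj prod.reindex inj inner_axis
        prod_nonneg inner_diff_left simp flip: ennreal_mult)
  ultimately show "emeasure (distr (lborel \<Otimes>\<^sub>M lborel) borel
      (\<lambda>(x, y). (\<chi> i. if i = 1 then x else y) :: 'a ^ 2)) (box l u)
      = ennreal (\<Prod>b\<in>Basis. (u - l) \<bullet> b)"
    using borel_measurable_vec2
    by (subst emeasure_distr) (auto simp: lborel_prod space_pair_measure)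
qed simp


text \<open>Fubini's theorem separates the two complex variables, and the planar formula is applied
  to each in turn, the inner one first; the two densities multiply.\<close>

lemma nn_integral_neg_ln_norm_vec2:
  assumes [measurable]: "case_prod F \<in> borel_measurable borel"
  shows "(\<integral>\<^sup>+z. F (- ln (norm ((z :: complex ^ 2) $ 1))) (- ln (norm (z $ 2))) \<partial>lborel)
    = (\<integral>\<^sup>+s. \<integral>\<^sup>+t. ennreal (4 * pi\<^sup>2 * exp (- (2 * s + 2 * t))) * F s t \<partial>lborel \<partial>lborel)"
proof -
  have F [measurable]: "case_prod F \<in> borel_measurable (borel \<Otimes>\<^sub>M borel)"
    using assms by (simp add: borel_prod)
  have [measurable]: "(\<lambda>z :: complex ^ 2. z $ i) \<in> borel_measurable borel" for i
    by (intro borel_measurable_continuous_onI continuous_intros)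
  have "(\<lambda>z :: complex ^ 2. case_prod F (- ln (norm (z $ 1)), - ln (norm (z $ 2)))) \<in> borel_measurable borel"
    by (rule measurable_compose[OF _ F]) measurable
  then have meas: "(\<lambda>z :: complex ^ 2. F (- ln (norm (z $ 1))) (- ln (norm (z $ 2)))) \<in> borel_measurable borel"
    by simp
  have "(\<integral>\<^sup>+z. F (- ln (norm ((z :: complex ^ 2) $ 1))) (- ln (norm (z $ 2))) \<partial>lborel)
      = (\<integral>\<^sup>+p. F (- ln (norm (fst p))) (- ln (norm (snd p)))
          \<partial>(lborel \<Otimes>\<^sub>M lborel :: (complex \<times> complex) measure))"
    using borel_measurable_vec2[where 'a = complex] meas
    by (subst lborel_vec2_eq_distr, subst nn_integral_distr)
      (auto simp: case_prod_beta lborel_prod)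
  also have "\<dots> = (\<integral>\<^sup>+z. \<integral>\<^sup>+w. F (- ln (norm (z :: complex))) (- ln (norm (w :: complex)))
      \<partial>lborel \<partial>lborel)"
    by (subst lborel.nn_integral_fst[symmetric]) auto
  also have "\<dots> = (\<integral>\<^sup>+z. \<integral>\<^sup>+t. ennreal (2 * pi * exp (- 2 * t)) * F (- ln (norm (z :: complex))) t
      \<partial>lborel \<partial>lborel)"
    by (subst nn_integral_neg_ln_norm) auto
  also have "\<dots> = (\<integral>\<^sup>+s. ennreal (2 * pi * exp (- 2 * s))
      * (\<integral>\<^sup>+t. ennreal (2 * pi * exp (- 2 * t)) * F s t \<partial>lborel) \<partial>lborel)"
    by (rule nn_integral_neg_ln_norm) measurable
  also have "\<dots> = (\<integral>\<^sup>+s. \<integral>\<^sup>+t. ennreal (4 * pi\<^sup>2 * exp (- (2 * s + 2 * t))) * F s t \<partial>lborel \<partial>lborel)"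
  proof (intro nn_integral_cong)
    fix s
    have "ennreal (2 * pi * exp (- 2 * s)) * (ennreal (2 * pi * exp (- 2 * t)) * F s t)
        = ennreal (4 * pi\<^sup>2 * exp (- (2 * s + 2 * t))) * F s t" for t
    proof -
      have "4 * pi\<^sup>2 * exp (- (2 * s + 2 * t)) = (2 * pi * exp (- 2 * s)) * (2 * pi * exp (- 2 * t))"
        by (simp add: power2_eq_square flip: exp_add)
      then show ?thesis
        by (simp only: mult.assoc ennreal_mult' exp_ge_zero pi_ge_zero zero_le_numeral zero_le_mult_iff)
    qed
    then show "ennreal (2 * pi * exp (- 2 * s)) * (\<integral>\<^sup>+t. ennreal (2 * pi * exp (- 2 * t)) * F s t \<partial>lborel)
        = (\<integral>\<^sup>+t. ennreal (4 * pi\<^sup>2 * exp (- (2 * s + 2 * t))) * F s t \<partial>lborel)"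
      by (subst nn_integral_cmult[symmetric]) simp_all
  qed
  finally show ?thesis .
qed

section \<open>Exponential integrals over the cone\<close>

text \<open>The map to \<open>u = a * s - b * t\<close>, \<open>v = d * t - c * s\<close> has
  determinant \<open>a * d - b * c\<close> and turns the cone into the open quadrant, where the
  exponential factors. It is carried out as two one-dimensional affine substitutions with an
  exchange of integrals between them.\<close>

lemma nn_integral_cone_exp:
  fixes a b c d A B :: real
  assumes "0 < b" and D: "0 < a * d - b * c"
  shows "(\<integral>\<^sup>+s. \<integral>\<^sup>+t. indicator {(s, t). b * t < a * s \<and> c * s < d * t} (s, t)
        * ennreal (exp (- (A * s + B * t))) \<partial>lborel \<partial>lborel)
    = ennreal (1 / (a * d - b * c))
      * ((\<integral>\<^sup>+u. indicator {0<..} u * ennreal (exp (- ((A * d + B * c) / (a * d - b * c) * u))) \<partial>lborel)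
      * (\<integral>\<^sup>+v. indicator {0<..} v * ennreal (exp (- ((A * b + B * a) / (a * d - b * c) * v))) \<partial>lborel))"
    (is "_ = ennreal (1 / ?D) * ((\<integral>\<^sup>+u. ?f u \<partial>lborel) * (\<integral>\<^sup>+v. ?g v \<partial>lborel))")
proof -
  define G where "G = (\<lambda>s t. indicator {(s, t). b * t < a * s \<and> c * s < d * t} (s, t)
        * ennreal (exp (- (A * s + B * t))))"
  have [measurable]: "case_prod G \<in> borel_measurable (borel \<Otimes>\<^sub>M borel)"
    unfolding G_def case_prod_beta by measurable
  \<comment> \<open>The first argument is \<open>s\<close> in terms of \<open>u\<close> and
    \<open>v\<close>; the second is \<open>t = (a * s - u) / b\<close>.\<close>
  have G: "G (d / ?D * u + b / ?D * v) (a / b * (d / ?D * u + b / ?D * v) + - 1 / b * u) = ?f u * ?g v"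
    for u v
  proof -
    define s where "s = d / ?D * u + b / ?D * v"
    define t where "t = a / b * s + - 1 / b * u"
    have s: "s = (d * u + b * v) / ?D"
      by (simp add: s_def add_divide_distrib)
    have "b * t = a * s - u"
      using \<open>0 < b\<close> by (simp add: t_def field_simps)
    also have "\<dots> = b * ((c * u + a * v) / ?D)"
      using D by (simp add: s field_simps)
    finally have t: "t = (c * u + a * v) / ?D"
      using \<open>0 < b\<close> by (metis mult_left_cancel less_irrefl)
    have u: "a * s - b * t = u"
      using \<open>b * t = a * s - u\<close> by simp
    have v: "d * t - c * s = v"
      using D by (simp add: s t divide_simps) (simp add: algebra_simps)
    have "A * s + B * t = (A * d + B * c) / ?D * u + (A * b + B * a) / ?D * v"
      using D by (simp add: s t divide_simps) (simp add: algebra_simps)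
    then have E: "exp (- (A * s + B * t))
        = exp (- ((A * d + B * c) / ?D * u)) * exp (- ((A * b + B * a) / ?D * v))"
      by (simp add: exp_add[symmetric])
    have "b * t < a * s \<longleftrightarrow> 0 < u" "c * s < d * t \<longleftrightarrow> 0 < v"
      using u v by auto
    then show ?thesis
      unfolding G_def s_def[symmetric] unfolding t_def[symmetric] E
      by (auto simp: indicator_def ennreal_mult)
  qed
  \<comment> \<open>At fixed \<open>s\<close>, replace \<open>t\<close> by \<open>u\<close>; the
    factor is \<open>1 / b\<close>.\<close>
  have "(\<integral>\<^sup>+s. \<integral>\<^sup>+t. G s t \<partial>lborel \<partial>lborel)
      = (\<integral>\<^sup>+s. ennreal (1 / b) * (\<integral>\<^sup>+u. G s (a / b * s + - 1 / b * u) \<partial>lborel) \<partial>lborel)"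
    using \<open>0 < b\<close>
    by (intro nn_integral_cong, subst nn_integral_real_affine[where c = "- 1 / b"]) auto
  also have "\<dots> = ennreal (1 / b) * (\<integral>\<^sup>+s. \<integral>\<^sup>+u. G s (a / b * s + - 1 / b * u) \<partial>lborel \<partial>lborel)"
    by (intro nn_integral_cmult) measurable
  also have "\<dots> = ennreal (1 / b) * (\<integral>\<^sup>+u. \<integral>\<^sup>+s. G s (a / b * s + - 1 / b * u) \<partial>lborel \<partial>lborel)"
    by (subst lborel_pair.Fubini') auto
  also have "\<dots> = ennreal (1 / b) * (\<integral>\<^sup>+u. ennreal (b / ?D) * (\<integral>\<^sup>+v. ?f u * ?g v \<partial>lborel) \<partial>lborel)"
  proof (intro arg_cong2[where f = times] refl nn_integral_cong)
    fix u
    \<comment> \<open>At fixed \<open>u\<close>, replace \<open>s\<close> by \<open>v\<close>; the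
      factor \<open>b / ?D\<close> combines with the earlier \<open>1 / b\<close> to
      \<open>1 / ?D\<close>.\<close>
    have "(\<integral>\<^sup>+s. G s (a / b * s + - 1 / b * u) \<partial>lborel)
        = ennreal \<bar>b / ?D\<bar> * (\<integral>\<^sup>+v. G (d / ?D * u + b / ?D * v)
            (a / b * (d / ?D * u + b / ?D * v) + - 1 / b * u) \<partial>lborel)"
      using \<open>0 < b\<close> D by (intro nn_integral_real_affine) auto
    also have "\<dots> = ennreal (b / ?D) * (\<integral>\<^sup>+v. ?f u * ?g v \<partial>lborel)"
      unfolding G using \<open>0 < b\<close> D by simp
    finally show "(\<integral>\<^sup>+s. G s (a / b * s + - 1 / b * u) \<partial>lborel)
        = ennreal (b / ?D) * (\<integral>\<^sup>+v. ?f u * ?g v \<partial>lborel)" .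
  qed
  also have "\<dots> = ennreal (1 / b) * (ennreal (b / ?D) * ((\<integral>\<^sup>+u. ?f u \<partial>lborel) * (\<integral>\<^sup>+v. ?g v \<partial>lborel)))"
    by (simp add: nn_integral_cmult nn_integral_multc)
  also have "\<dots> = ennreal (1 / ?D) * ((\<integral>\<^sup>+u. ?f u \<partial>lborel) * (\<integral>\<^sup>+v. ?g v \<partial>lborel))"
    using \<open>0 < b\<close> D by (simp add: mult.assoc[symmetric] ennreal_mult[symmetric])
  finally show ?thesis
    by (simp add: G_def)
qed

lemma nn_integral_cone_exp_finite_iff:
  fixes a b c d A B :: real
  assumes "0 < b" and "0 < a * d - b * c"
  shows "(\<integral>\<^sup>+s. \<integral>\<^sup>+t. indicator {(s, t). b * t < a * s \<and> c * s < d * t} (s, t)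
        * ennreal (exp (- (A * s + B * t))) \<partial>lborel \<partial>lborel) < \<infinity>
    \<longleftrightarrow> 0 < A * d + B * c \<and> 0 < A * b + B * a"
proof -
  have "ennreal k * (x * y) < \<infinity> \<longleftrightarrow> x < \<infinity> \<and> y < \<infinity>" if "0 < k" "0 < x" "0 < y" for k x y
    using that by (auto simp: ennreal_mult_less_top)
  note fin = this[OF _ nn_integral_exp_Ioi_pos nn_integral_exp_Ioi_pos]
  show ?thesis
    unfolding nn_integral_cone_exp[OF assms]
    by (subst fin) (use assms(2) in \<open>simp_all only: nn_integral_exp_Ioi_finite_iff zero_less_divide_iff, auto\<close>)
qed

section \<open>Laurent monomials on the domain and the allowable indices\<close>

lemma laurent_monomial_2:
  "laurent_monomial \<alpha> z = (z $ 1) powi (\<alpha> $ 1) * (z $ 2) powi (\<alpha> $ 2)"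
  for \<alpha> :: "int ^ 2"
  by (simp add: laurent_monomial_def UNIV_2)

text \<open>Off the coordinate axes the product rule applies even to negative powers, and the
  derivative is a combination of \<open>v $ 1\<close> and \<open>v $ 2\<close> with complex
  coefficients, hence complex linear.\<close>

lemma holomorphic_cn_laurent_monomial_2:
  fixes \<alpha> :: "int ^ 2"
  assumes "\<And>z. z \<in> S \<Longrightarrow> z $ 1 \<noteq> 0 \<and> z $ 2 \<noteq> 0"
  shows "holomorphic_cn (laurent_monomial \<alpha>) S"
  unfolding holomorphic_cn_def
proof
  fix z assume "z \<in> S"
  with assms have "z $ 1 \<noteq> 0" "z $ 2 \<noteq> 0" by auto
  then have "((\<lambda>z. (z $ 1) powi (\<alpha> $ 1) * (z $ 2) powi (\<alpha> $ 2)) has_derivative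
      (\<lambda>v. (z $ 1) powi (\<alpha> $ 1) * (v $ 2 * (of_int (\<alpha> $ 2) * (z $ 2) powi (\<alpha> $ 2 - 1)))
        + v $ 1 * (of_int (\<alpha> $ 1) * (z $ 1) powi (\<alpha> $ 1 - 1)) * (z $ 2) powi (\<alpha> $ 2))) (at z)"
    by (intro has_derivative_mult has_derivative_power_int
        bounded_linear_imp_has_derivative bounded_linear_vec_nth) auto
  then show "\<exists>f'. (laurent_monomial \<alpha> has_derivative f') (at z) \<and> (\<forall>c v. f' (c *s v) = c * f' v)"
    unfolding laurent_monomial_2[abs_def]
    by (intro exI conjI allI) (assumption, simp add: algebra_simps)
qed

text \<open>For nonzero coordinates, take logarithms. If a coordinate vanishes,
  \<open>ln 0 = 0\<close> makes the two inequalities on the right contradict each other, and the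
  point is outside the domain as well.\<close>

lemma mem_Omega_A_iff:
  assumes "a > 0" "b > 0" "c > 0" "d > 0"
  shows "z \<in> Omega_A a b c d \<longleftrightarrow>
    real b * - ln (norm (z $ 2)) < real a * - ln (norm (z $ 1)) \<and>
    real c * - ln (norm (z $ 1)) < real d * - ln (norm (z $ 2))"
proof (cases "z $ 1 = 0 \<or> z $ 2 = 0")
  case True
  with assms show ?thesis
    by (auto simp: Omega_A_def zero_power mult_less_0_iff zero_less_mult_iff not_less
        intro: ccontr)
next
  case False
  have "x ^ m < y ^ n \<longleftrightarrow> real m * ln x < real n * ln y" if "0 < x" "0 < y" for x y :: real and m n
    using that by (simp flip: ln_realpow)
  with False show ?thesis
    by (auto simp: Omega_A_def)
qed

lemma Omega_A_nonzero:
  assumes "a > 0" "b > 0" "c > 0" "d > 0" and "z \<in> Omega_A a b c d"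
  shows "z $ 1 \<noteq> 0" "z $ 2 \<noteq> 0"
  using assms by (auto simp: Omega_A_def zero_power)

lemma nn_integral_laurent_monomial_Omega_A:
  fixes \<alpha> :: "int ^ 2"
  assumes "a > 0" "b > 0" "c > 0" "d > 0"
  shows "(\<integral>\<^sup>+z\<in>Omega_A a b c d. ennreal (norm (laurent_monomial \<alpha> z) powr p) \<partial>lebesgue)
    = ennreal (4 * pi\<^sup>2) * (\<integral>\<^sup>+s. \<integral>\<^sup>+t.
        indicator {(s, t). real b * t < real a * s \<and> real c * s < real d * t} (s, t)
        * ennreal (exp (- ((p * real_of_int (\<alpha> $ 1) + 2) * s + (p * real_of_int (\<alpha> $ 2) + 2) * t)))
        \<partial>lborel \<partial>lborel)"
proof -
  let ?K = "{(s, t). real b * t < real a * s \<and> real c * s < real d * t}"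
  define F where "F = (\<lambda>s t. indicator ?K (s, t)
    * ennreal (exp (- (p * (real_of_int (\<alpha> $ 1) * s + real_of_int (\<alpha> $ 2) * t)))))"
  have [measurable]: "case_prod F \<in> borel_measurable borel"
    unfolding F_def case_prod_beta borel_prod[symmetric] by measurable
  have "ennreal (norm (laurent_monomial \<alpha> z) powr p) * indicator (Omega_A a b c d) z
      = F (- ln (norm (z $ 1))) (- ln (norm (z $ 2)))" for z
  proof (cases "z \<in> Omega_A a b c d")
    case True
    note nz = Omega_A_nonzero[OF assms True]
    have "norm (z $ i) powi n = exp (real_of_int n * ln (norm (z $ i)))" if "z $ i \<noteq> 0" for i n
      using that by (metis norm_ge_zero norm_eq_zero powr_def powr_real_of_int')
    with nz have "norm (laurent_monomial \<alpha> z)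
        = exp (real_of_int (\<alpha> $ 1) * ln (norm (z $ 1)) + real_of_int (\<alpha> $ 2) * ln (norm (z $ 2)))"
      by (simp add: laurent_monomial_2 norm_mult norm_power_int exp_add)
    then have "norm (laurent_monomial \<alpha> z) powr p
        = exp (p * (real_of_int (\<alpha> $ 1) * ln (norm (z $ 1)) + real_of_int (\<alpha> $ 2) * ln (norm (z $ 2))))"
      by (simp add: powr_def)
    with True mem_Omega_A_iff[OF assms, of z] show ?thesis
      by (simp add: F_def algebra_simps)
  next
    case False
    with mem_Omega_A_iff[OF assms, of z] show ?thesis
      by (auto simp: F_def indicator_def)
  qed
  then have "(\<integral>\<^sup>+z\<in>Omega_A a b c d. ennreal (norm (laurent_monomial \<alpha> z) powr p) \<partial>lebesgue)
      = (\<integral>\<^sup>+z. F (- ln (norm ((z :: complex ^ 2) $ 1))) (- ln (norm (z $ 2))) \<partial>lborel)"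
    by (simp add: nn_integral_completion)
  also have "\<dots> = (\<integral>\<^sup>+s. \<integral>\<^sup>+t. ennreal (4 * pi\<^sup>2 * exp (- (2 * s + 2 * t))) * F s t \<partial>lborel \<partial>lborel)"
    by (rule nn_integral_neg_ln_norm_vec2) measurable
  \<comment> \<open>The density \<open>exp (- (2 * s + 2 * t))\<close> is absorbed into the
    exponent; this is the origin of the two summands 2.\<close>
  also have "\<dots> = (\<integral>\<^sup>+s. \<integral>\<^sup>+t. ennreal (4 * pi\<^sup>2) * (indicator ?K (s, t)
      * ennreal (exp (- ((p * real_of_int (\<alpha> $ 1) + 2) * s + (p * real_of_int (\<alpha> $ 2) + 2) * t))))
      \<partial>lborel \<partial>lborel)"
  proof (intro nn_integral_cong)
    fix s t
    have reorder: "ennreal (k * x) * (i * ennreal y) = ennreal k * (i * ennreal z)"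
      if "x * y = z" "0 \<le> k" "0 \<le> x" for k x y z and i :: ennreal
      using that by (auto simp: ennreal_mult' mult_ac)
    have "exp (- (2 * s + 2 * t)) * exp (- (p * (real_of_int (\<alpha> $ 1) * s + real_of_int (\<alpha> $ 2) * t)))
        = exp (- ((p * real_of_int (\<alpha> $ 1) + 2) * s + (p * real_of_int (\<alpha> $ 2) + 2) * t))"
      unfolding exp_add[symmetric] by (rule arg_cong[where f = exp]) (simp add: algebra_simps)
    then show "ennreal (4 * pi\<^sup>2 * exp (- (2 * s + 2 * t))) * F s t = ennreal (4 * pi\<^sup>2) * (indicator ?K (s, t)
      * ennreal (exp (- ((p * real_of_int (\<alpha> $ 1) + 2) * s + (p * real_of_int (\<alpha> $ 2) + 2) * t))))"
      unfolding F_def by (intro reorder) auto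
  qed
  also have "\<dots> = ennreal (4 * pi\<^sup>2) * (\<integral>\<^sup>+s. \<integral>\<^sup>+t. indicator ?K (s, t)
      * ennreal (exp (- ((p * real_of_int (\<alpha> $ 1) + 2) * s + (p * real_of_int (\<alpha> $ 2) + 2) * t)))
      \<partial>lborel \<partial>lborel)"
    by (simp add: nn_integral_cmult)
  finally show ?thesis .
qed

text \<open>The domain avoids the coordinate axes, so every monomial is holomorphic there and
  integrability alone decides. The cone criterion with \<open>A = p * \<alpha> $ 1 + 2\<close> and
  \<open>B = p * \<alpha> $ 2 + 2\<close> gives the two inequalities.\<close>

lemma allowable_Omega_A:
  assumes "a > 0" "b > 0" "c > 0" "d > 0" and "int a * int d - int b * int c > 0"
  shows "allowable p (Omega_A a b c d) =
    {\<alpha>. (real a * real_of_int (\<alpha> $ 2) + real b * real_of_int (\<alpha> $ 1)) * p > - 2 * (real a + real b) \<and>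
        (real c * real_of_int (\<alpha> $ 2) + real d * real_of_int (\<alpha> $ 1)) * p > - 2 * (real c + real d)}"
proof -
  have D: "0 < real a * real d - real b * real c"
  proof -
    have "0 < real_of_int (int a * int d - int b * int c)"
      using assms(5) by (simp only: of_int_0_less_iff)
    then show ?thesis by simp
  qed
  have hol: "holomorphic_cn (laurent_monomial \<alpha>) (Omega_A a b c d)" for \<alpha> :: "int ^ 2"
    using Omega_A_nonzero[OF assms(1-4)] by (intro holomorphic_cn_laurent_monomial_2) auto
  have "\<alpha> \<in> allowable p (Omega_A a b c d) \<longleftrightarrow>
      0 < (p * real_of_int (\<alpha> $ 1) + 2) * real d + (p * real_of_int (\<alpha> $ 2) + 2) * real c \<and>
      0 < (p * real_of_int (\<alpha> $ 1) + 2) * real b + (p * real_of_int (\<alpha> $ 2) + 2) * real a" for \<alpha> :: "int ^ 2"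
  proof -
    have "ennreal (4 * pi\<^sup>2) * x < \<infinity> \<longleftrightarrow> x < \<infinity>" for x
      by (auto simp: ennreal_mult_less_top)
    then show ?thesis
      unfolding allowable_def bergman_space_def mem_Collect_eq
        nn_integral_laurent_monomial_Omega_A[OF assms(1-4)]
      using nn_integral_cone_exp_finite_iff[OF _ D] assms(2) hol by simp
  qed
  moreover have "0 < (p * x + 2) * u + (p * y + 2) * v \<longleftrightarrow> (v * y + u * x) * p > - 2 * (v + u)"
    for x y u v :: real
  proof -
    have "(p * x + 2) * u + (p * y + 2) * v = (v * y + u * x) * p + 2 * (v + u)"
      by algebra
    then show ?thesis by linarith
  qed
  ultimately show ?thesis
    by blast
qed

section \<open>Threshold exponents\<close>

text \<open>For exponents at least 1 the inequality always holds if \<open>m \<ge> 0\<close> and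
  always fails if \<open>m \<le> - N\<close>. Only finitely many \<open>m\<close> remain, and for
  each of them \<open>- m * p\<close> differs from \<open>N\<close>, so its truth value is constant
  near \<open>p\<close>.\<close>

lemma threshold_inequality_stable:
  fixes p :: real and N :: int
  assumes "\<And>j. 1 \<le> j \<Longrightarrow> j \<le> N - 1 \<Longrightarrow> p \<noteq> real_of_int N / real_of_int j" and "1 \<le> p" "0 < N"
  shows "\<forall>\<^sub>F q in nhds p. 1 \<le> q \<longrightarrow>
    (\<forall>m::int. real_of_int m * q > - real_of_int N \<longleftrightarrow> real_of_int m * p > - real_of_int N)"
proof -
  have "\<forall>\<^sub>F q in nhds p. \<forall>j\<in>{1..N - 1}. real_of_int j * q < real_of_int N \<longleftrightarrow> real_of_int j * p < real_of_int N"
  proof (intro eventually_ball_finite ballI)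
    fix j assume "j \<in> {1..N - 1}"
    with assms have "real_of_int j * p \<noteq> real_of_int N"
      by (auto simp: field_simps)
    moreover have lim: "((\<lambda>q. real_of_int j * q) \<longlongrightarrow> real_of_int j * p) (nhds p)"
      by (rule tendsto_mult[OF tendsto_const filterlim_ident])
    ultimately show "\<forall>\<^sub>F q in nhds p. real_of_int j * q < real_of_int N \<longleftrightarrow> real_of_int j * p < real_of_int N"
      using order_tendstoD[OF lim, of "real_of_int N"]
      by (cases "real_of_int j * p < real_of_int N") (auto elim!: eventually_mono)
  qed simp
  then show ?thesis
  proof eventually_elim
    case (elim q)
    show ?case
    proof (intro impI allI)
      fix m :: int
      assume "1 \<le> q"
      consider "0 \<le> m" | "- m \<in> {1..N - 1}" | "m \<le> - N"
        by fastforce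
      then show "real_of_int m * q > - real_of_int N \<longleftrightarrow> real_of_int m * p > - real_of_int N"
      proof cases
        case 1
        then have "0 \<le> real_of_int m * q" "0 \<le> real_of_int m * p" "0 < real_of_int N"
          using \<open>1 \<le> q\<close> \<open>1 \<le> p\<close> \<open>0 < N\<close> by auto
        then show ?thesis by linarith
      next
        case 2
        with elim have "real_of_int (- m) * q < real_of_int N \<longleftrightarrow> real_of_int (- m) * p < real_of_int N"
          by blast
        then show ?thesis by auto
      next
        case 3
        have "real_of_int m * r \<le> - real_of_int N" if "1 \<le> r" for r :: real
        proof -
          have "real_of_int m * r \<le> real_of_int m * 1"
            using 3 that \<open>0 < N\<close> by (intro mult_left_mono_neg) auto
          with 3 show ?thesis by linarith
        qed
        with \<open>1 \<le> q\<close> \<open>1 \<le> p\<close> show ?thesis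
          by (simp add: not_less[symmetric])
      qed
    qed
  qed
qed

text \<open>For the coefficient \<open>- j\<close> there is equality at \<open>p\<close>, so the
  strict inequality holds just to the left of \<open>p\<close>. Since \<open>j < N\<close> gives
  \<open>p > 1\<close>, there is room for such an exponent at or above 1.\<close>

lemma threshold_inequality_jump:
  fixes N j :: int
  assumes "1 \<le> j" "j \<le> N - 1" and p: "p = real_of_int N / real_of_int j" and "0 < \<epsilon>"
  shows "1 \<le> p"
    and "\<exists>q\<in>{p - \<epsilon><..<p + \<epsilon>}. 1 \<le> q \<and> real_of_int (- j) * q > - real_of_int N"
proof -
  have "1 < p"
    using assms by (simp add: less_divide_eq)
  then show "1 \<le> p" by simp
  \<comment> \<open>The maximum keeps \<open>q\<close> at least 1, and halving
    \<open>\<epsilon>\<close> keeps it strictly inside the interval.\<close>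
  define q where "q = max 1 (p - \<epsilon> / 2)"
  have "q < p"
    using \<open>1 < p\<close> \<open>0 < \<epsilon>\<close> by (simp add: q_def)
  then have "real_of_int (- j) * q > - real_of_int N"
    using assms by (simp add: field_simps)
  moreover have "q \<in> {p - \<epsilon><..<p + \<epsilon>}" "1 \<le> q"
    using \<open>1 < p\<close> \<open>0 < \<epsilon>\<close> by (auto simp: q_def)
  ultimately show "\<exists>q\<in>{p - \<epsilon><..<p + \<epsilon>}. 1 \<le> q \<and> real_of_int (- j) * q > - real_of_int N"
    by blast
qed

text \<open>Used to isolate one inequality: the first linear form takes a prescribed value, while
  the nonnegative second form satisfies its own inequality at every
  \<open>q \<ge> 1\<close>.\<close>

lemma obtain_exponents:
  fixes a b c d k :: int
  assumes "gcd a b = 1" and D: "0 < a * d - b * c"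
  obtains x y where "a * y + b * x = k" and "0 \<le> c * y + d * x"
proof -
  obtain u v where uv: "u * a + v * b = 1"
    using bezout_int[of a b] assms(1) by auto
  txt \<open>Shifting a solution \<open>(x, y)\<close> along \<open>(a, - b)\<close> keeps \<open>a y + b x\<close> and raises \<open>c y + d x\<close>.\<close>
  define n where "n = c * (k * u) + d * (k * v)"
  have "\<bar>n\<bar> * 1 \<le> \<bar>n\<bar> * (a * d - b * c)"
    using D by (intro mult_left_mono) auto
  then have "0 \<le> n + \<bar>n\<bar> * (a * d - b * c)"
    by linarith
  also have "\<dots> = c * (k * u - \<bar>n\<bar> * b) + d * (k * v + \<bar>n\<bar> * a)"
    by (simp add: n_def algebra_simps)
  finally have "0 \<le> c * (k * u - \<bar>n\<bar> * b) + d * (k * v + \<bar>n\<bar> * a)" .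
  moreover have "a * (k * u - \<bar>n\<bar> * b) + b * (k * v + \<bar>n\<bar> * a) = k * (u * a + v * b)"
    by (simp add: algebra_simps)
  ultimately show ?thesis
    using that uv by simp
qed

lemma Threshold_Omega_A:
  assumes pos: "a > 0" "b > 0" "c > 0" "d > 0"
    and D: "int a * int d - int b * int c > 0"
    and gcd: "gcd a b = 1" "gcd c d = 1"
  shows "Threshold (Omega_A a b c d) =
           {2 * (real a + real b) / real_of_int j | j::int.
              1 \<le> j \<and> j \<le> 2 * (int a + int b) - 1} \<union>
           {2 * (real c + real d) / real_of_int k | k::int.
              1 \<le> k \<and> k \<le> 2 * (int c + int d) - 1}"
    (is "?T = ?J \<union> ?K")
proof -
  define M N where "M = 2 * (int a + int b)" and "N = 2 * (int c + int d)"
  define m n where "m = (\<lambda>\<alpha> :: int ^ 2. int a * \<alpha> $ 2 + int b * \<alpha> $ 1)"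
    and "n = (\<lambda>\<alpha> :: int ^ 2. int c * \<alpha> $ 2 + int d * \<alpha> $ 1)"
  define S where "S = (\<lambda>p. allowable p (Omega_A a b c d))"
  have S: "\<alpha> \<in> S p \<longleftrightarrow> real_of_int (m \<alpha>) * p > - real_of_int M \<and> real_of_int (n \<alpha>) * p > - real_of_int N"
    for \<alpha> p
    by (simp add: S_def allowable_Omega_A[OF pos D] m_def n_def M_def N_def)
  have MN: "0 < M" "0 < N"
    using pos by (auto simp: M_def N_def)
  have J: "?J = {real_of_int M / real_of_int j | j. 1 \<le> j \<and> j \<le> M - 1}"
    and K: "?K = {real_of_int N / real_of_int k | k. 1 \<le> k \<and> k \<le> N - 1}"
    by (simp_all add: M_def N_def)
  \<comment> \<open>Away from the listed values both inequalities are stable near \<open>p\<close>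
    simultaneously for all coefficients, so the index set is locally constant there.\<close>
  have "p \<in> ?J \<union> ?K" if "p \<in> ?T" for p
  proof (rule ccontr)
    assume "p \<notin> ?J \<union> ?K"
    then have nJ: "\<And>j. 1 \<le> j \<Longrightarrow> j \<le> M - 1 \<Longrightarrow> p \<noteq> real_of_int M / real_of_int j"
      and nK: "\<And>k. 1 \<le> k \<Longrightarrow> k \<le> N - 1 \<Longrightarrow> p \<noteq> real_of_int N / real_of_int k"
      unfolding J K by blast+
    have p: "1 \<le> p" "\<forall>\<epsilon>>0. \<exists>q\<in>{p - \<epsilon><..<p + \<epsilon>}. 1 \<le> q \<and> S q \<noteq> S p"
      using that by (auto simp: Threshold_def S_def)
    have "\<forall>\<^sub>F q in nhds p. 1 \<le> q \<longrightarrow>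
        (\<forall>l::int. real_of_int l * q > - real_of_int M \<longleftrightarrow> real_of_int l * p > - real_of_int M)"
      by (rule threshold_inequality_stable) (use nJ p MN in auto)
    moreover have "\<forall>\<^sub>F q in nhds p. 1 \<le> q \<longrightarrow>
        (\<forall>l::int. real_of_int l * q > - real_of_int N \<longleftrightarrow> real_of_int l * p > - real_of_int N)"
      by (rule threshold_inequality_stable) (use nK p MN in auto)
    ultimately have "\<forall>\<^sub>F q in nhds p. 1 \<le> q \<longrightarrow> S q = S p"
      by eventually_elim (simp add: set_eq_iff S)
    then obtain \<epsilon> where "0 < \<epsilon>" "\<And>q. dist q p < \<epsilon> \<Longrightarrow> 1 \<le> q \<Longrightarrow> S q = S p"
      unfolding eventually_nhds_metric by blast
    with p(2) show False
      by (force simp: dist_real_def abs_less_iff)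
  qed
  moreover have "p \<in> ?T" if "p \<in> ?J" for p
  proof -
    from that obtain j where j: "1 \<le> j" "j \<le> M - 1" and p: "p = real_of_int M / real_of_int j"
      unfolding J by blast
    \<comment> \<open>This index fails the first inequality at \<open>p\<close>, by equality, but is
      allowable for suitable \<open>q < p\<close> arbitrarily close to \<open>p\<close>.\<close>
    obtain x y where xy: "int a * y + int b * x = - j" "0 \<le> int c * y + int d * x"
      using obtain_exponents[OF _ D, of "- j"] gcd(1) by (metis gcd_int_int_eq of_nat_1)
    define \<alpha> :: "int ^ 2" where "\<alpha> = vector [x, y]"
    have \<alpha>: "m \<alpha> = - j" "0 \<le> n \<alpha>"
      using xy by (simp_all add: m_def n_def \<alpha>_def)
    have "\<alpha> \<notin> S p"
      using j by (simp add: S \<alpha> p)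
    moreover have "\<alpha> \<in> S q" if "1 \<le> q" "real_of_int (- j) * q > - real_of_int M" for q
    proof -
      have "0 \<le> real_of_int (n \<alpha>) * q" "0 < real_of_int N"
        using \<alpha> that MN by simp_all
      then have "- real_of_int N < real_of_int (n \<alpha>) * q"
        by linarith
      with that show ?thesis
        by (simp add: S \<alpha>)
    qed
    ultimately have "\<exists>q\<in>{p - \<epsilon><..<p + \<epsilon>}. 1 \<le> q \<and> S q \<noteq> S p" if "0 < \<epsilon>" for \<epsilon>
      using threshold_inequality_jump(2)[OF j p that] by metis
    with threshold_inequality_jump(1)[OF j p zero_less_one] show ?thesis
      by (simp add: Threshold_def S_def)
  qed
  moreover have "p \<in> ?T" if "p \<in> ?K" for p
  proof -
    from that obtain k where k: "1 \<le> k" "k \<le> N - 1" and p: "p = real_of_int N / real_of_int k"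
      unfolding K by blast
    have gcd': "gcd (int d) (int c) = 1"
      using gcd(2) by (subst gcd.commute) simp
    \<comment> \<open>Exchanging \<open>(a, b)\<close> with \<open>(d, c)\<close> preserves the
      determinant, so the previous argument applies to the second inequality.\<close>
    have D': "0 < int d * int a - int c * int b"
      using D by (simp only: mult.commute)
    obtain x y where xy: "int d * x + int c * y = - k" "0 \<le> int b * x + int a * y"
      using obtain_exponents[OF gcd' D', of "- k"] by blast
    define \<alpha> :: "int ^ 2" where "\<alpha> = vector [x, y]"
    have \<alpha>: "n \<alpha> = - k" "0 \<le> m \<alpha>"
      using xy by (simp_all add: m_def n_def \<alpha>_def add.commute)
    have "\<alpha> \<notin> S p"
      using k by (simp add: S \<alpha> p)
    moreover have "\<alpha> \<in> S q" if "1 \<le> q" "real_of_int (- k) * q > - real_of_int N" for q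
    proof -
      have "0 \<le> real_of_int (m \<alpha>) * q" "0 < real_of_int M"
        using \<alpha> that MN by simp_all
      then have "- real_of_int M < real_of_int (m \<alpha>) * q"
        by linarith
      with that show ?thesis
        by (simp add: S \<alpha>)
    qed
    ultimately have "\<exists>q\<in>{p - \<epsilon><..<p + \<epsilon>}. 1 \<le> q \<and> S q \<noteq> S p" if "0 < \<epsilon>" for \<epsilon>
      using threshold_inequality_jump(2)[OF k p that] by metis
    with threshold_inequality_jump(1)[OF k p zero_less_one] show ?thesis
      by (simp add: Threshold_def S_def)
  qed
  ultimately show ?thesis
    by blast
qed

theorem proposition4p3:
  fixes a b c d :: nat
  assumes "a > 0" and "b > 0" and "c > 0" and "d > 0"
    and "int a * int d - int b * int c > 0"
    and "gcd a b = 1" and "gcd c d = 1"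
  shows "(\<forall>p::real. 1 \<le> p \<longrightarrow>
            allowable p (Omega_A a b c d) =
              {\<alpha> :: int ^ 2.
                 (real a * real_of_int (\<alpha> $ 2) + real b * real_of_int (\<alpha> $ 1)) * p
                   > - 2 * (real a + real b) \<and>
                 (real c * real_of_int (\<alpha> $ 2) + real d * real_of_int (\<alpha> $ 1)) * p
                   > - 2 * (real c + real d)}) \<and>
         Threshold (Omega_A a b c d) =
           {2 * (real a + real b) / real_of_int j | j::int.
              1 \<le> j \<and> j \<le> 2 * (int a + int b) - 1} \<union>
           {2 * (real c + real d) / real_of_int k | k::int.
              1 \<le> k \<and> k \<le> 2 * (int c + int d) - 1}"
  using allowable_Omega_A[OF assms(1-5)] Threshold_Omega_A[OF assms] by blast

end
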